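(* Let $R$ be a commutative ring with Jacobson radical $\mathfrak{J}$. Then the clopen subsets of $\operatorname{Max}(R)$ in the Zariski topology are precisely the sets of the form $\operatorname{Max}(R)\cap D(f)$ where $f\in R$ satisfies $f(1-f)\in\mathfrak{J}$.
   Context: All rings are commutative with $1$. $\operatorname{Max}(R)$ is the set of maximal ideals of $R$ with the Zariski topology, i.e., the subspace topology from $\operatorname{Spec}(R)$. For $f\in R$, $D(f)=\{\mathfrak{p}\in\operatorname{Spec}(R): f\notin\mathfrak{p}\}$. Clopen means both open and closed. *)

theory Defs
  imports "HOL-Algebra.Ideal" "HOL-Analysis.Abstract_Topology"
begin

definition spec :: "('a, 'b) ring_scheme \<Rightarrow> 'a set set"
  where "spec R = {p. primeideal p R}"

definition max_spec :: "('a, 'b) ring_scheme \<Rightarrow> 'a set set"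
  where "max_spec R = {m. maximalideal m R}"

definition basic_open :: "('a, 'b) ring_scheme \<Rightarrow> 'a \<Rightarrow> 'a set set"
  where "basic_open R f = {p \<in> spec R. f \<notin> p}"

text \<open>Intersecting with the carrier matters only for the zero ring, which has no maximal ideals
  and whose Jacobson radical is the whole ring.\<close>

definition jacobson_radical :: "('a, 'b) ring_scheme \<Rightarrow> 'a set"
  where "jacobson_radical R = carrier R \<inter> \<Inter> (max_spec R)"

definition vanishing_set :: "('a, 'b) ring_scheme \<Rightarrow> 'a set \<Rightarrow> 'a set set"
  where "vanishing_set R E = {p \<in> spec R. E \<subseteq> p}"

definition zariski_topology :: "('a, 'b) ring_scheme \<Rightarrow> 'a set topology"
  where "zariski_topology R =
    topology (\<lambda>U. \<exists>E \<subseteq> carrier R. U = spec R - vanishing_set R E)"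

definition max_spec_topology :: "('a, 'b) ring_scheme \<Rightarrow> 'a set topology"
  where "max_spec_topology R = subtopology (zariski_topology R) (max_spec R)"

lemma vanishing_set_Un:
  fixes R (structure)
  assumes E: "E \<subseteq> carrier R" and F: "F \<subseteq> carrier R"
  shows "vanishing_set R E \<union> vanishing_set R F =
    vanishing_set R {e \<otimes> f | e f. e \<in> E \<and> f \<in> F}" (is "_ = vanishing_set R ?P")
proof (intro equalityI subsetI)
  fix p assume "p \<in> vanishing_set R E \<union> vanishing_set R F"
  then have p: "primeideal p R" and sub: "E \<subseteq> p \<or> F \<subseteq> p"
    by (auto simp: vanishing_set_def spec_def)
  interpret primeideal p R by (rule p)
  have "?P \<subseteq> p"
    using sub E F by (auto intro: I_l_closed I_r_closed)
  then show "p \<in> vanishing_set R ?P"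
    using p by (simp add: vanishing_set_def spec_def)
next
  fix p assume "p \<in> vanishing_set R ?P"
  then have p: "primeideal p R" and sub: "?P \<subseteq> p"
    by (auto simp: vanishing_set_def spec_def)
  interpret primeideal p R by (rule p)
  have "E \<subseteq> p \<or> F \<subseteq> p"
  proof (rule ccontr)
    assume "\<not> (E \<subseteq> p \<or> F \<subseteq> p)"
    then obtain e f where "e \<in> E" "e \<notin> p" "f \<in> F" "f \<notin> p" by blast
    then show False using I_prime[of e f] E F sub by blast
  qed
  then show "p \<in> vanishing_set R E \<union> vanishing_set R F"
    using p by (auto simp: vanishing_set_def spec_def)
qed

lemma istopology_zariski:
  "istopology (\<lambda>U. \<exists>E \<subseteq> carrier R. U = spec R - vanishing_set R E)"
  unfolding istopology_def
proof (intro conjI allI impI)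
  fix S T
  assume "\<exists>E \<subseteq> carrier R. S = spec R - vanishing_set R E"
    and "\<exists>E \<subseteq> carrier R. T = spec R - vanishing_set R E"
  then obtain E F where EF: "E \<subseteq> carrier R" "F \<subseteq> carrier R"
    and ST: "S = spec R - vanishing_set R E" "T = spec R - vanishing_set R F" by blast
  let ?P = "{e \<otimes>\<^bsub>R\<^esub> f | e f. e \<in> E \<and> f \<in> F}"
  have eq: "S \<inter> T = spec R - vanishing_set R ?P"
    using vanishing_set_Un[OF EF] ST by blast
  show "\<exists>E \<subseteq> carrier R. S \<inter> T = spec R - vanishing_set R E"
  proof (cases "spec R = {}")
    case True
    then show ?thesis using ST by auto
  next
    case False
    then obtain p where "primeideal p R" by (auto simp: spec_def)
    then interpret primeideal p R .
    have "?P \<subseteq> carrier R" using EF by auto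
    then show ?thesis using eq by blast
  qed
next
  fix \<K>
  assume K: "\<forall>K\<in>\<K>. \<exists>E \<subseteq> carrier R. K = spec R - vanishing_set R E"
  then obtain E where E: "\<And>K. K \<in> \<K> \<Longrightarrow> E K \<subseteq> carrier R"
    "\<And>K. K \<in> \<K> \<Longrightarrow> K = spec R - vanishing_set R (E K)" by metis
  have "\<Union>\<K> = (\<Union>K\<in>\<K>. spec R - vanishing_set R (E K))"
    using E(2) by auto
  also have "\<dots> = spec R - vanishing_set R (\<Union>K\<in>\<K>. E K)"
    by (auto simp: vanishing_set_def)
  finally show "\<exists>E \<subseteq> carrier R. \<Union>\<K> = spec R - vanishing_set R E"
    using E(1) by (intro exI[of _ "\<Union>K\<in>\<K>. E K"]) blast
qed

lemma openin_zariski_topology: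
  "openin (zariski_topology R) U \<longleftrightarrow> (\<exists>E \<subseteq> carrier R. U = spec R - vanishing_set R E)"
  unfolding zariski_topology_def by (simp add: topology_inverse' istopology_zariski)

lemma topspace_zariski_topology: "topspace (zariski_topology R) = spec R"
proof -
  have "carrier R \<subseteq> p \<Longrightarrow> p \<notin> spec R" for p
  proof
    assume sub: "carrier R \<subseteq> p" and "p \<in> spec R"
    then interpret primeideal p R by (simp add: spec_def)
    show False using I_notcarr sub a_subset by blast
  qed
  then have "vanishing_set R (carrier R) = {}"
    by (auto simp: vanishing_set_def)
  then have "openin (zariski_topology R) (spec R)"
    unfolding openin_zariski_topology by (intro exI[of _ "carrier R"]) auto
  moreover have "topspace (zariski_topology R) \<subseteq> spec R"
    using openin_topspace[of "zariski_topology R"] unfolding openin_zariski_topology by auto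
  ultimately show ?thesis
    by (simp add: openin_subset subset_antisym)
qed

lemma topspace_max_spec_topology:
  assumes "cring R"
  shows "topspace (max_spec_topology R) = max_spec R"
  using cring.maximalideal_prime[OF assms]
  by (auto simp: max_spec_topology_def topspace_zariski_topology spec_def max_spec_def)

end

theory Submission
  imports Defs "HOL-Algebra.Ring_Divisibility"
begin

text \<open>If a clopen set and its complement are cut out of the maximal spectrum by the non-vanishing of
  \<open>E\<close> and \<open>F\<close>, then no maximal ideal contains both \<open>E\<close> and \<open>F\<close>, so the ideals they generate are
  comaximal. Writing \<open>\<one> = f \<oplus> g\<close> accordingly, \<open>f\<close> lies in exactly the maximal ideals containing
  \<open>E\<close>, and \<open>f \<otimes> g\<close> lies in all of them. Conversely, if \<open>f \<otimes> (\<one> \<ominus> f)\<close> lies in every maximal ideal,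
  then each one contains exactly one of \<open>f\<close> and \<open>\<one> \<ominus> f\<close>.\<close>

text \<open>Krull's theorem, by Zorn's lemma: an ideal is proper exactly when it misses
  \<open>\<one>\<close>, and this condition survives unions of chains.\<close>

lemma (in ring) proper_ideal_subset_maximalideal:
  assumes I: "ideal I R" and one: "\<one> \<notin> I"
  shows "\<exists>M. maximalideal M R \<and> I \<subseteq> M"
proof -
  define A where "A = {J. ideal J R \<and> I \<subseteq> J \<and> \<one> \<notin> J}"
  have "\<exists>M\<in>A. \<forall>X\<in>A. M \<subseteq> X \<longrightarrow> X = M"
  proof (rule subset_Zorn_nonempty)
    show "A \<noteq> {}"
      using I one by (auto simp: A_def)
  next
    fix C assume C: "C \<noteq> {}" "subset.chain A C"
    then have sub: "C \<subseteq> A" and chain: "subset.chain {J. ideal J R} C"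
      by (auto simp: A_def pred_on.chain_def)
    \<comment> \<open>Nonemptiness of \<open>C\<close> matters: the empty union is not an ideal and
      need not contain \<open>I\<close>.\<close>
    have "ideal (\<Union>C) R"
      using chain_Union_is_ideal[OF chain] C(1) by simp
    moreover have "I \<subseteq> \<Union>C" "\<one> \<notin> \<Union>C"
      using sub C(1) unfolding A_def by blast+
    ultimately show "\<Union>C \<in> A"
      by (simp add: A_def)
  qed
  then obtain M where M: "M \<in> A" and max: "\<And>X. X \<in> A \<Longrightarrow> M \<subseteq> X \<Longrightarrow> X = M"
    by blast
  have "maximalideal M R"
  proof (rule maximalidealI)
    show "ideal M R" "carrier R \<noteq> M"
      using M by (auto simp: A_def)
  next
    fix J assume J: "ideal J R" "M \<subseteq> J"
    show "J = M \<or> J = carrier R"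
    proof (cases "\<one> \<in> J")
      case True
      then show ?thesis using ideal.one_imp_carrier[OF J(1)] by blast
    next
      case False
      then show ?thesis using max[of J] M J by (auto simp: A_def)
    qed
  qed
  then show ?thesis using M by (auto simp: A_def)
qed

text \<open>Since maximal ideals are prime, open sets can be described by maximal ideals alone, and
  \<open>spec R\<close> drops out of the later arguments.\<close>

lemma (in cring) openin_max_spec_topology:
  "openin (max_spec_topology R) U \<longleftrightarrow> (\<exists>E \<subseteq> carrier R. U = {m \<in> max_spec R. \<not> E \<subseteq> m})"
proof -
  have "max_spec R \<subseteq> spec R"
    using maximalideal_prime by (auto simp: max_spec_def spec_def)
  then have "(spec R - vanishing_set R E) \<inter> max_spec R = {m \<in> max_spec R. \<not> E \<subseteq> m}" for E
    by (auto simp: vanishing_set_def)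
  then show ?thesis
    unfolding max_spec_topology_def openin_subtopology openin_zariski_topology by blast
qed

lemma (in cring) max_spec_Int_basic_open:
  "max_spec R \<inter> basic_open R f = {m \<in> max_spec R. f \<notin> m}"
  using maximalideal_prime by (auto simp: max_spec_def basic_open_def spec_def)

lemma (in cring) one_minus_notin_maximalideal:
  assumes "maximalideal m R" and "f \<in> m"
  shows "\<one> \<ominus> f \<notin> m"
proof
  assume mem: "\<one> \<ominus> f \<in> m"
  interpret maximalideal m R by fact
  have "(\<one> \<ominus> f) \<oplus> f = \<one>"
    using assms(2) Icarr by (simp add: minus_eq a_assoc l_neg)
  then have "\<one> \<in> m"
    using a_closed[OF mem assms(2)] by simp
  then show False
    using one_imp_carrier I_notcarr by simp
qed

text \<open>Primality of \<open>m\<close> puts at least one factor into \<open>m\<close>; both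
  cannot be there, because they sum to \<open>\<one>\<close>.\<close>

lemma (in cring) mem_maximalideal_iff_one_minus:
  assumes f: "f \<in> carrier R" and jac: "f \<otimes> (\<one> \<ominus> f) \<in> jacobson_radical R"
    and m: "m \<in> max_spec R"
  shows "f \<in> m \<longleftrightarrow> \<one> \<ominus> f \<notin> m"
proof -
  have max: "maximalideal m R"
    using m by (simp add: max_spec_def)
  interpret primeideal m R
    by (rule maximalideal_prime[OF max])
  have "f \<otimes> (\<one> \<ominus> f) \<in> m"
    using jac m by (auto simp: jacobson_radical_def)
  then have "f \<in> m \<or> \<one> \<ominus> f \<in> m"
    using f I_prime by simp
  then show ?thesis
    using one_minus_notin_maximalideal[OF max] by blast
qed

text \<open>If the sum of the two generated ideals were proper, a maximal ideal above it would
  contain both \<open>E\<close> and \<open>F\<close>.\<close>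

lemma (in cring) comaximal_partition_of_unity:
  assumes E: "E \<subseteq> carrier R" and F: "F \<subseteq> carrier R"
    and comax: "\<And>m. m \<in> max_spec R \<Longrightarrow> \<not> (E \<subseteq> m \<and> F \<subseteq> m)"
  shows "\<exists>f. f \<in> Idl E \<and> \<one> \<ominus> f \<in> Idl F"
proof -
  have idl: "ideal (Idl E) R" "ideal (Idl F) R"
    using E F by (simp_all add: genideal_ideal)
  have "\<one> \<in> Idl (Idl E \<union> Idl F)"
  proof (rule ccontr)
    assume "\<one> \<notin> Idl (Idl E \<union> Idl F)"
    moreover have carr: "Idl E \<union> Idl F \<subseteq> carrier R"
      using ideal.Icarr[OF idl(1)] ideal.Icarr[OF idl(2)] by blast
    ultimately obtain m where m: "maximalideal m R" "Idl (Idl E \<union> Idl F) \<subseteq> m"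
      using proper_ideal_subset_maximalideal genideal_ideal by blast
    then have "E \<subseteq> m" "F \<subseteq> m"
      using genideal_self[OF carr] genideal_self[OF E] genideal_self[OF F] by blast+
    then show False
      using comax m(1) by (simp add: max_spec_def)
  qed
  \<comment> \<open>The ideal generated by a union of two ideals is their sum, so membership of
    \<open>\<one>\<close> is a decomposition.\<close>
  then obtain f g where fg: "f \<in> Idl E" "g \<in> Idl F" "\<one> = f \<oplus> g"
    unfolding union_genideal[OF idl] by (auto simp: set_add_defs)
  have "f \<in> carrier R" "g \<in> carrier R"
    using fg ideal.Icarr[OF idl(1)] ideal.Icarr[OF idl(2)] by blast+
  then have "\<one> \<ominus> f = g"
    using fg(3) by algebra
  then show ?thesis
    using fg by blast
qed

theorem theorem3p15:
  fixes R :: "('a, 'b) ring_scheme" (structure)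
  assumes "cring R"
  shows "{U. openin (max_spec_topology R) U \<and> closedin (max_spec_topology R) U} =
    {max_spec R \<inter> basic_open R f | f. f \<in> carrier R \<and> f \<otimes> (\<one> \<ominus> f) \<in> jacobson_radical R}"
proof -
  interpret cring R by fact
  note closedin = closedin_def topspace_max_spec_topology[OF assms]
  show ?thesis
  proof (intro equalityI subsetI)
    fix U assume "U \<in> {U. openin (max_spec_topology R) U \<and> closedin (max_spec_topology R) U}"
    then obtain E F where E: "E \<subseteq> carrier R" "U = {m \<in> max_spec R. \<not> E \<subseteq> m}"
      and F: "F \<subseteq> carrier R" "max_spec R - U = {m \<in> max_spec R. \<not> F \<subseteq> m}"
      by (auto simp: closedin openin_max_spec_topology)
    have iff: "E \<subseteq> m \<longleftrightarrow> \<not> F \<subseteq> m" if "m \<in> max_spec R" for m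
      using E(2) F(2) that by blast
    then obtain f where f: "f \<in> Idl E" "\<one> \<ominus> f \<in> Idl F"
      using comaximal_partition_of_unity[OF E(1) F(1)] by blast
    have carr: "f \<in> carrier R"
      using f(1) ideal.Icarr[OF genideal_ideal[OF E(1)]] by blast
    have *: "(f \<in> m \<longleftrightarrow> E \<subseteq> m) \<and> f \<otimes> (\<one> \<ominus> f) \<in> m" if m: "m \<in> max_spec R" for m
    proof -
      have max: "maximalideal m R"
        using m by (simp add: max_spec_def)
      then interpret maximalideal m R .
      \<comment> \<open>Exactly one of \<open>E\<close> and \<open>F\<close> lies in
        \<open>m\<close>, and the ideal it generates lies there too. In either case \<open>m\<close>
        contains a factor of the product.\<close>
      consider "E \<subseteq> m" "f \<in> m" | "\<not> E \<subseteq> m" "\<one> \<ominus> f \<in> m"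
        using f iff[OF m] genideal_minimal[OF is_ideal] by blast
      then show ?thesis
        using one_minus_notin_maximalideal[OF max] carr
        by cases (auto intro: I_l_closed I_r_closed)
    qed
    then have "U = max_spec R \<inter> basic_open R f"
      unfolding max_spec_Int_basic_open using E(2) by blast
    moreover have "f \<otimes> (\<one> \<ominus> f) \<in> jacobson_radical R"
      using * carr by (simp add: jacobson_radical_def)
    ultimately show "U \<in> {max_spec R \<inter> basic_open R f | f.
        f \<in> carrier R \<and> f \<otimes> (\<one> \<ominus> f) \<in> jacobson_radical R}"
      using carr by blast
  next
    fix U assume "U \<in> {max_spec R \<inter> basic_open R f | f.
        f \<in> carrier R \<and> f \<otimes> (\<one> \<ominus> f) \<in> jacobson_radical R}"
    then obtain f where f: "f \<in> carrier R" "f \<otimes> (\<one> \<ominus> f) \<in> jacobson_radical R"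
      and U: "U = {m \<in> max_spec R. f \<notin> m}"
      unfolding max_spec_Int_basic_open by blast
    have "openin (max_spec_topology R) U"
      unfolding openin_max_spec_topology using f(1) U by (intro exI[of _ "{f}"]) auto
    \<comment> \<open>Closedness: the complement of the non-vanishing set of \<open>f\<close> is the
      non-vanishing set of \<open>\<one> \<ominus> f\<close>, hence open.\<close>
    moreover have "max_spec R - U = {m \<in> max_spec R. \<not> {\<one> \<ominus> f} \<subseteq> m}"
      using mem_maximalideal_iff_one_minus[OF f] U by auto
    then have "openin (max_spec_topology R) (max_spec R - U)"
      unfolding openin_max_spec_topology using f(1) by (intro exI[of _ "{\<one> \<ominus> f}"]) auto
    ultimately show "U \<in> {U. openin (max_spec_topology R) U \<and> closedin (max_spec_topology R) U}"
      using U by (auto simp: closedin)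
  qed
qed

end
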